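(* Let $F$ be a field of characteristic $0$, let $A$ be a finite-dimensional simple algebra over $F$ with a comultiplication $\Delta:A\to A\otimes A$, and suppose that the Drinfeld double $D(A)$ of $(A,\Delta)$ is a direct sum $D(A)=A_1\oplus A_2$ of two simple ideals $A_1,A_2$. Let $\phi_1,\phi_2:A^*\to A$ be the linear maps determined by $f-\phi_i(f)\in A_i$ for all $f\in A^*$, and let $\psi:A\to A^*$ be the linear isomorphism determined by $a=-\phi_1(\psi(a))+\phi_2(\psi(a))$ for all $a\in A$. Then the operator $Q:A\to A$ defined by $$Q(a)=\phi_2(\psi(a))\qquad (a\in A)$$ is a Rota-Baxter operator of weight $-1$ on $A$.
   Context: Algebras are not assumed associative, commutative or unital. An algebra is simple if its product is not identically zero and it has no two-sided ideals other than $0$ and itself. A comultiplication on a vector space $A$ is a linear map $\Delta:A\to A\otimes A$; write $\Delta(a)=\sum a_{(1)}\otimes a_{(2)}$. The dual space $A^*$ is an algebra with product $(fg)(a)=\sum f(a_{(1)})g(a_{(2)})$. For $a,b\in A$ and $f\in A^*$ put $$f\rightharpoonup a=\sum a_{(1)}f(a_{(2)})\in A,\qquad a\leftharpoonup f=\sum f(a_{(1)})a_{(2)}\in A,$$ and define $f\leftharpoondown a\in A^*$ and $b\rightharpoondown f\in A^*$ by $$(f\leftharpoondown a)(b)=f(ab),\qquad (b\rightharpoondown f)(a)=f(ab).$$ The Drinfeld double of $(A,\Delta)$ is the vector space $D(A)=A\oplus A^*$ with the multiplication $$(a+f)(b+g)=(ab+f\rightharpoonup b+a\leftharpoonup g)+(fg+f\leftharpoondown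 b+a\rightharpoondown g),\quad a,b\in A,\ f,g\in A^*.$$ $A$ and $A^*$ are subalgebras of $D(A)$. It is known that for simple $A$ every proper nonzero ideal of $D(A)$ has dimension $\dim A$; thus $\dim A_1=\dim A_2=\dim A$. For each $f\in A^*$ there is a unique $\phi_i(f)\in A$ with $f-\phi_i(f)\in A_i$ ($i=1,2$), and for each $a\in A$ there is a unique $f\in A^*$ with $a=-\phi_1(f)+\phi_2(f)$; this $f$ is $\psi(a)$. For $\lambda\in F$, a linear operator $Q:A\to A$ is a Rota-Baxter operator of weight $\lambda$ if $Q(x)Q(y)=Q(Q(x)y+xQ(y)+\lambda xy)$ for all $x,y\in A$. *)

theory Defs
  imports Complex_Main "HOL-Library.Poly_Mapping" "HOL-Library.Function_Algebras"
    "HOL-Library.Product_Plus"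
begin

section \<open>Algebras, ideals and simplicity\<close>

definition bilinear_map ::
    "('f::field \<Rightarrow> 'a::ab_group_add \<Rightarrow> 'a) \<Rightarrow> ('f \<Rightarrow> 'v::ab_group_add \<Rightarrow> 'v) \<Rightarrow> ('a \<Rightarrow> 'a \<Rightarrow> 'v) \<Rightarrow> bool"
  where "bilinear_map scale scaleV \<beta> \<longleftrightarrow>
    (\<forall>x. Vector_Spaces.linear scale scaleV (\<lambda>y. \<beta> x y)) \<and>
    (\<forall>y. Vector_Spaces.linear scale scaleV (\<lambda>x. \<beta> x y))"

text \<open>A basis is a parameter because the library locale for finite-dimensional spaces has one.\<close>

locale finite_dimensional_algebra = finite_dimensional_vector_space scale Basis
  for scale :: "'f::field \<Rightarrow> 'a::ab_group_add \<Rightarrow> 'a" and Basis :: "'a set" +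
  fixes mul :: "'a \<Rightarrow> 'a \<Rightarrow> 'a"
  assumes bilinear_mul: "bilinear_map scale scale mul"

text \<open>
  The next notions are relative to a carrier \<open>S\<close>, a subspace closed under \<open>mul\<close>, so that they
  apply to the double and to its ideals, which are not whole types.
\<close>

definition two_sided_ideal ::
    "('f::field \<Rightarrow> 'v::ab_group_add \<Rightarrow> 'v) \<Rightarrow> ('v \<Rightarrow> 'v \<Rightarrow> 'v) \<Rightarrow> 'v set \<Rightarrow> 'v set \<Rightarrow> bool"
  where "two_sided_ideal scale mul S I \<longleftrightarrow>
    module.subspace scale I \<and> I \<subseteq> S \<and> (\<forall>x\<in>S. \<forall>y\<in>I. mul x y \<in> I \<and> mul y x \<in> I)"

definition simple_algebra ::
    "('f::field \<Rightarrow> 'v::ab_group_add \<Rightarrow> 'v) \<Rightarrow> ('v \<Rightarrow> 'v \<Rightarrow> 'v) \<Rightarrow> 'v set \<Rightarrow> bool"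
  where "simple_algebra scale mul S \<longleftrightarrow>
    (\<exists>x\<in>S. \<exists>y\<in>S. mul x y \<noteq> 0) \<and>
    (\<forall>I. two_sided_ideal scale mul S I \<longrightarrow> I = {0} \<or> I = S)"

definition direct_sum :: "'v::ab_group_add set \<Rightarrow> 'v set \<Rightarrow> 'v set \<Rightarrow> bool"
  where "direct_sum S U V \<longleftrightarrow> S = {u + v |u v. u \<in> U \<and> v \<in> V} \<and> U \<inter> V = {0}"

definition rota_baxter ::
    "('f::field \<Rightarrow> 'a::ab_group_add \<Rightarrow> 'a) \<Rightarrow> ('a \<Rightarrow> 'a \<Rightarrow> 'a) \<Rightarrow> 'f \<Rightarrow> ('a \<Rightarrow> 'a) \<Rightarrow> bool"
  where "rota_baxter scale mul w Q \<longleftrightarrow>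
    Vector_Spaces.linear scale scale Q \<and>
    (\<forall>x y. mul (Q x) (Q y) = Q (mul (Q x) y + mul x (Q y) + scale w (mul x y)))"


section \<open>The tensor square\<close>

text \<open>
  \<open>A \<otimes> A\<close> is the quotient of the vector space freely generated by \<open>A \<times> A\<close> (finitely supported
  functions) by the span of the bilinearity relations. Its elements are cosets, represented as
  sets, since a type cannot depend on the scalar multiplication \<open>scale\<close>.
\<close>

type_synonym ('a, 'f) free_pairs = "('a \<times> 'a) \<Rightarrow>\<^sub>0 'f"

abbreviation free_scale :: "'f::field \<Rightarrow> ('a, 'f) free_pairs \<Rightarrow> ('a, 'f) free_pairs"
  where "free_scale c p \<equiv> Poly_Mapping.map ((*) c) p"

abbreviation free_gen :: "'a \<Rightarrow> 'a \<Rightarrow> ('a, 'f::field) free_pairs"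
  where "free_gen x y \<equiv> Poly_Mapping.single (x, y) 1"

definition tensor_relations ::
    "('f::field \<Rightarrow> 'a::ab_group_add \<Rightarrow> 'a) \<Rightarrow> ('a, 'f) free_pairs set"
  where "tensor_relations scale = module.span free_scale
    ({free_gen (x + x') y - free_gen x y - free_gen x' y |x x' y. True} \<union>
     {free_gen x (y + y') - free_gen x y - free_gen x y' |x y y'. True} \<union>
     {free_gen (scale c x) y - free_scale c (free_gen x y) |c x y. True} \<union>
     {free_gen x (scale c y) - free_scale c (free_gen x y) |c x y. True})"

definition tensor_class ::
    "('f::field \<Rightarrow> 'a::ab_group_add \<Rightarrow> 'a) \<Rightarrow> ('a, 'f) free_pairs \<Rightarrow> ('a, 'f) free_pairs set"
  where "tensor_class scale p = {q. q - p \<in> tensor_relations scale}"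

definition tensor_square ::
    "('f::field \<Rightarrow> 'a::ab_group_add \<Rightarrow> 'a) \<Rightarrow> ('a, 'f) free_pairs set set"
  where "tensor_square scale = range (tensor_class scale)"

definition tensor_add ::
    "('a, 'f::field) free_pairs set \<Rightarrow> ('a, 'f) free_pairs set \<Rightarrow> ('a, 'f) free_pairs set"
  where "tensor_add T U = {p + q |p q. p \<in> T \<and> q \<in> U}"

text \<open>The relations are added back so that the result is a full coset also for \<open>c = 0\<close>.\<close>

definition tensor_scale ::
    "('f::field \<Rightarrow> 'a::ab_group_add \<Rightarrow> 'a) \<Rightarrow> 'f \<Rightarrow> ('a, 'f) free_pairs set \<Rightarrow> ('a, 'f) free_pairs set"
  where "tensor_scale scale c T = {free_scale c p + r |p r. p \<in> T \<and> r \<in> tensor_relations scale}"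

definition comultiplication ::
    "('f::field \<Rightarrow> 'a::ab_group_add \<Rightarrow> 'a) \<Rightarrow> ('a \<Rightarrow> ('a, 'f) free_pairs set) \<Rightarrow> bool"
  where "comultiplication scale \<Delta> \<longleftrightarrow>
    (\<forall>a. \<Delta> a \<in> tensor_square scale) \<and>
    (\<forall>a b. \<Delta> (a + b) = tensor_add (\<Delta> a) (\<Delta> b)) \<and>
    (\<forall>c a. \<Delta> (scale c a) = tensor_scale scale c (\<Delta> a))"

definition free_eval ::
    "('f::field \<Rightarrow> 'v::ab_group_add \<Rightarrow> 'v) \<Rightarrow> ('a \<Rightarrow> 'a \<Rightarrow> 'v) \<Rightarrow> ('a, 'f) free_pairs \<Rightarrow> 'v"
  where "free_eval scaleV \<beta> p =
    (\<Sum>(x, y) \<in> Poly_Mapping.keys p. scaleV (Poly_Mapping.lookup p (x, y)) (\<beta> x y))"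

text \<open>
  For bilinear \<open>\<beta>\<close> this is the linear map induced on the tensor square: at \<open>\<Delta> a\<close> its value is
  the Sweedler expression \<open>\<Sum> \<beta> a\<^sub>1 a\<^sub>2\<close>. The image is then a singleton
  (lemma \<open>tensor_lift_class\<close> below).
\<close>

definition tensor_lift ::
    "('f::field \<Rightarrow> 'v::ab_group_add \<Rightarrow> 'v) \<Rightarrow> ('a \<Rightarrow> 'a \<Rightarrow> 'v) \<Rightarrow> ('a, 'f) free_pairs set \<Rightarrow> 'v"
  where "tensor_lift scaleV \<beta> T = the_elem (free_eval scaleV \<beta> ` T)"

lemma lookup_free_scale: "Poly_Mapping.lookup (free_scale c p) z = c * Poly_Mapping.lookup p z"
  by (simp add: map.rep_eq when_def)

lemma vector_space_free_scale:
  "vector_space (free_scale :: 'f::field \<Rightarrow> ('a, 'f) free_pairs \<Rightarrow> _)"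
  by unfold_locales
    (auto intro!: poly_mapping_eqI simp: lookup_add lookup_free_scale algebra_simps)

lemma free_eval_superset:
  assumes "vector_space scaleV" "finite K" "Poly_Mapping.keys p \<subseteq> K"
  shows "free_eval scaleV \<beta> p = (\<Sum>z\<in>K. scaleV (Poly_Mapping.lookup p z) (\<beta> (fst z) (snd z)))"
proof -
  interpret vector_space scaleV by fact
  show ?thesis
    unfolding free_eval_def case_prod_beta
    by (rule sum.mono_neutral_cong_left) (use assms in \<open>auto simp: in_keys_iff\<close>)
qed

lemma free_eval_add:
  assumes "vector_space scaleV"
  shows "free_eval scaleV \<beta> (p + q) = free_eval scaleV \<beta> p + free_eval scaleV \<beta> q"
proof -
  interpret vector_space scaleV by fact
  let ?K = "Poly_Mapping.keys p \<union> Poly_Mapping.keys q"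
  have "Poly_Mapping.keys (p + q) \<subseteq> ?K" by (rule Poly_Mapping.keys_add)
  then show ?thesis
    by (simp add: free_eval_superset[OF assms, of ?K] lookup_add scale_left_distrib sum.distrib)
qed

lemma free_eval_scale:
  assumes "vector_space scaleV"
  shows "free_eval scaleV \<beta> (free_scale c p) = scaleV c (free_eval scaleV \<beta> p)"
proof -
  interpret vector_space scaleV by fact
  let ?K = "Poly_Mapping.keys p"
  have "Poly_Mapping.keys (free_scale c p) \<subseteq> ?K"
    by (auto simp: in_keys_iff lookup_free_scale)
  then show ?thesis
    by (simp add: free_eval_superset[OF assms, of ?K] scale_sum_right lookup_free_scale)
qed

lemma free_eval_gen:
  assumes "vector_space scaleV"
  shows "free_eval scaleV \<beta> (free_gen x y) = \<beta> x y"
proof -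
  interpret vector_space scaleV by fact
  show ?thesis by (simp add: free_eval_def)
qed

lemma linear_free_eval:
  assumes "vector_space scaleV"
  shows "Vector_Spaces.linear free_scale scaleV (free_eval scaleV \<beta>)"
proof -
  interpret vector_space scaleV by fact
  interpret F: vector_space free_scale by (rule vector_space_free_scale)
  show ?thesis
    by unfold_locales (simp_all add: free_eval_add free_eval_scale assms)
qed

lemma free_eval_relations:
  assumes V: "vector_space scaleV" and \<beta>: "bilinear_map scale scaleV \<beta>"
    and r: "r \<in> tensor_relations scale"
  shows "free_eval scaleV \<beta> r = 0"
proof -
  interpret E: Vector_Spaces.linear free_scale scaleV "free_eval scaleV \<beta>"
    by (rule linear_free_eval[OF V])
  have R: "Vector_Spaces.linear scale scaleV (\<lambda>y. \<beta> x y)"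
    and L: "Vector_Spaces.linear scale scaleV (\<lambda>x. \<beta> x y)" for x y
    using \<beta> by (auto simp: bilinear_map_def)
  have add1: "\<beta> (x + x') y = \<beta> x y + \<beta> x' y" and scale1: "\<beta> (scale c x) y = scaleV c (\<beta> x y)" for x x' y c
    using module_hom.add[OF Vector_Spaces.linear.axioms(3)[OF L]]
      module_hom.scale[OF Vector_Spaces.linear.axioms(3)[OF L]] by blast+
  have add2: "\<beta> x (y + y') = \<beta> x y + \<beta> x y'" and scale2: "\<beta> x (scale c y) = scaleV c (\<beta> x y)" for x y y' c
    using module_hom.add[OF Vector_Spaces.linear.axioms(3)[OF R]]
      module_hom.scale[OF Vector_Spaces.linear.axioms(3)[OF R]] by blast+
  show ?thesis
    using r unfolding tensor_relations_def
  proof (rule E.eq_0_on_span[rotated])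
    fix s
    assume "s \<in> {free_gen (x + x') y - free_gen x y - free_gen x' y |x x' y. True} \<union>
     {free_gen x (y + y') - free_gen x y - free_gen x y' |x y y'. True} \<union>
     {free_gen (scale c x) y - free_scale c (free_gen x y) |c x y. True} \<union>
     {free_gen x (scale c y) - free_scale c (free_gen x y) |c x y. True}"
    then show "free_eval scaleV \<beta> s = 0"
      by (auto simp: E.diff free_eval_scale[OF V] free_eval_gen[OF V] add1 add2 scale1 scale2
          simp del: map_single)
  qed
qed

lemma tensor_lift_class:
  assumes V: "vector_space scaleV" and \<beta>: "bilinear_map scale scaleV \<beta>"
  shows "tensor_lift scaleV \<beta> (tensor_class scale p) = free_eval scaleV \<beta> p"
proof -
  interpret E: Vector_Spaces.linear free_scale scaleV "free_eval scaleV \<beta>"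
    by (rule linear_free_eval[OF V])
  have eq: "free_eval scaleV \<beta> q = free_eval scaleV \<beta> p" if "q \<in> tensor_class scale p" for q
    using free_eval_relations[OF V \<beta>, of "q - p"] that
    by (simp add: tensor_class_def E.diff)
  have "p \<in> tensor_class scale p"
    by (simp add: tensor_class_def tensor_relations_def E.vs1.span_zero)
  then have "free_eval scaleV \<beta> ` tensor_class scale p = {free_eval scaleV \<beta> p}"
    using eq by blast
  then show ?thesis by (simp add: tensor_lift_def)
qed


section \<open>The Drinfeld double\<close>

definition dual_space :: "('f::field \<Rightarrow> 'a::ab_group_add \<Rightarrow> 'a) \<Rightarrow> ('a \<Rightarrow> 'f) set"
  where "dual_space scale = {f. Vector_Spaces.linear scale (*) f}"

definition dual_mul ::
    "('a \<Rightarrow> ('a, 'f::field) free_pairs set) \<Rightarrow> ('a \<Rightarrow> 'f) \<Rightarrow> ('a \<Rightarrow> 'f) \<Rightarrow> ('a \<Rightarrow> 'f)"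
  where "dual_mul \<Delta> f g = (\<lambda>a. tensor_lift (*) (\<lambda>x y. f x * g y) (\<Delta> a))"

text \<open>The actions of functionals on elements, \<open>f \<rightharpoonup> a\<close> and \<open>a \<leftharpoonup> f\<close>.\<close>

definition dual_act_left ::
    "('f::field \<Rightarrow> 'a::ab_group_add \<Rightarrow> 'a) \<Rightarrow> ('a \<Rightarrow> ('a, 'f) free_pairs set) \<Rightarrow> ('a \<Rightarrow> 'f) \<Rightarrow> 'a \<Rightarrow> 'a"
  where "dual_act_left scale \<Delta> f a = tensor_lift scale (\<lambda>x y. scale (f y) x) (\<Delta> a)"

definition dual_act_right ::
    "('f::field \<Rightarrow> 'a::ab_group_add \<Rightarrow> 'a) \<Rightarrow> ('a \<Rightarrow> ('a, 'f) free_pairs set) \<Rightarrow> 'a \<Rightarrow> ('a \<Rightarrow> 'f) \<Rightarrow> 'a"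
  where "dual_act_right scale \<Delta> a f = tensor_lift scale (\<lambda>x y. scale (f x) y) (\<Delta> a)"

text \<open>The actions of elements on functionals, \<open>f \<leftharpoondown> a\<close> and \<open>b \<rightharpoondown> f\<close>.\<close>

definition alg_act_right :: "('a \<Rightarrow> 'a \<Rightarrow> 'a) \<Rightarrow> ('a \<Rightarrow> 'f) \<Rightarrow> 'a \<Rightarrow> ('a \<Rightarrow> 'f)"
  where "alg_act_right mul f a = (\<lambda>b. f (mul a b))"

definition alg_act_left :: "('a \<Rightarrow> 'a \<Rightarrow> 'a) \<Rightarrow> 'a \<Rightarrow> ('a \<Rightarrow> 'f) \<Rightarrow> ('a \<Rightarrow> 'f)"
  where "alg_act_left mul b f = (\<lambda>a. f (mul a b))"

text \<open>The element \<open>a + f\<close> of the double is the pair \<open>(a, f)\<close>; addition of pairs and of functions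
  is componentwise.\<close>

definition double :: "('f::field \<Rightarrow> 'a::ab_group_add \<Rightarrow> 'a) \<Rightarrow> ('a \<times> ('a \<Rightarrow> 'f)) set"
  where "double scale = UNIV \<times> dual_space scale"

definition double_scale ::
    "('f::field \<Rightarrow> 'a::ab_group_add \<Rightarrow> 'a) \<Rightarrow> 'f \<Rightarrow> 'a \<times> ('a \<Rightarrow> 'f) \<Rightarrow> 'a \<times> ('a \<Rightarrow> 'f)"
  where "double_scale scale c = (\<lambda>(a, f). (scale c a, \<lambda>x. c * f x))"

definition double_mul ::
    "('f::field \<Rightarrow> 'a::ab_group_add \<Rightarrow> 'a) \<Rightarrow> ('a \<Rightarrow> 'a \<Rightarrow> 'a) \<Rightarrow> ('a \<Rightarrow> ('a, 'f) free_pairs set) \<Rightarrow>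
      'a \<times> ('a \<Rightarrow> 'f) \<Rightarrow> 'a \<times> ('a \<Rightarrow> 'f) \<Rightarrow> 'a \<times> ('a \<Rightarrow> 'f)"
  where "double_mul scale mul \<Delta> = (\<lambda>(a, f) (b, g).
    (mul a b + dual_act_left scale \<Delta> f b + dual_act_right scale \<Delta> a g,
     dual_mul \<Delta> f g + alg_act_right mul f b + alg_act_left mul a g))"

text \<open>
  \<open>double_phi I f\<close> is the unique \<open>a\<close> with \<open>f - a \<in> I\<close>, and \<open>double_psi scale I J a\<close> is the
  unique functional \<open>f\<close> with \<open>a = - \<phi>\<^sub>I f + \<phi>\<^sub>J f\<close>.
\<close>

definition double_phi :: "('a::ab_group_add \<times> ('a \<Rightarrow> 'f::field)) set \<Rightarrow> ('a \<Rightarrow> 'f) \<Rightarrow> 'a"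
  where "double_phi I f = (THE a. (0, f) - (a, 0) \<in> I)"

definition double_psi ::
    "('f::field \<Rightarrow> 'a::ab_group_add \<Rightarrow> 'a) \<Rightarrow>
      ('a \<times> ('a \<Rightarrow> 'f)) set \<Rightarrow> ('a \<times> ('a \<Rightarrow> 'f)) set \<Rightarrow> 'a \<Rightarrow> ('a \<Rightarrow> 'f)"
  where "double_psi scale I J a =
    (THE f. f \<in> dual_space scale \<and> a = - double_phi I f + double_phi J f)"

end

theory Submission
  imports Defs
begin

text \<open>
  Let \<open>\<pi>\<close> be the projection of \<open>D(A)\<close> onto \<open>A\<^sub>2\<close> along \<open>A\<^sub>1\<close>. Simplicity of \<open>A\<close> forces
  \<open>A \<inter> A\<^sub>i = 0\<close>: otherwise \<open>A \<subseteq> A\<^sub>i\<close>, so \<open>A\<close> annihilates the other ideal \<open>A\<^sub>j\<close>; for \<open>b + f \<in> A\<^sub>j\<close> this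
  makes \<open>f\<close> vanish on the span of all products, which is \<open>A\<close>, so that
  \<open>A\<^sub>j \<subseteq> A \<inter> A\<^sub>j \<subseteq> A\<^sub>i \<inter> A\<^sub>j = 0\<close>. Hence
  \<open>a \<mapsto> - snd (\<pi> a)\<close> is injective from \<open>A\<close> to \<open>A\<^sup>*\<close>, so it is bijective; it is
  \<open>\<psi>\<close>, and \<open>\<pi> a = Q a - \<psi> a\<close> for \<open>a \<in> A\<close>. Since \<open>\<pi>\<close> is multiplicative and commutes with
  multiplications by elements of \<open>D(A)\<close>,
  \[ \pi (Q(a) b + a Q(b) - a b) = Q(a) \pi(b) + \pi(a) Q(b) - \pi(a) \pi(b)
     = Q(a) Q(b) - \psi(a) \psi(b), \]
  whose \<open>A\<close>-component is \<open>Q(a) Q(b)\<close>.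
\<close>

section \<open>Sweedler sums\<close>

text \<open>The relations form a subspace, so cosets can be added through representatives. This
  turns the set-level additivity in \<open>comultiplication\<close> into a statement about formal
  sums.\<close>

lemma tensor_add_class:
  "tensor_add (tensor_class scale p) (tensor_class scale q) = tensor_class scale (p + q)"
proof -
  interpret F: vector_space free_scale by (rule vector_space_free_scale)
  have add: "x + y \<in> tensor_relations scale"
    if "x \<in> tensor_relations scale" "y \<in> tensor_relations scale" for x y
    using that unfolding tensor_relations_def by (rule F.span_add)
  show ?thesis
  proof (intro equalityI subsetI)
    fix t assume "t \<in> tensor_add (tensor_class scale p) (tensor_class scale q)"
    then obtain p' q' where t: "t = p' + q'" "p' - p \<in> tensor_relations scale"
      "q' - q \<in> tensor_relations scale"
      by (auto simp: tensor_add_def tensor_class_def)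
    have "t - (p + q) = (p' - p) + (q' - q)" by (simp add: t(1))
    then show "t \<in> tensor_class scale (p + q)"
      using add[OF t(2,3)] by (simp only: tensor_class_def mem_Collect_eq)
  next
    fix t assume "t \<in> tensor_class scale (p + q)"
    then have "t - p \<in> tensor_class scale q" by (simp add: tensor_class_def algebra_simps)
    moreover have "p \<in> tensor_class scale p"
      by (simp add: tensor_class_def tensor_relations_def F.span_zero)
    moreover have "t = p + (t - p)" by simp
    ultimately show "t \<in> tensor_add (tensor_class scale p) (tensor_class scale q)"
      unfolding tensor_add_def by blast
  qed
qed

lemma comultiplication_classE:
  assumes "comultiplication scale \<Delta>"
  obtains p where "\<Delta> a = tensor_class scale p"
  using assms unfolding comultiplication_def tensor_square_def by blast

lemma tensor_lift_comult_add:
  assumes V: "vector_space scaleV" and \<beta>: "bilinear_map scale scaleV \<beta>"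
    and \<Delta>: "comultiplication scale \<Delta>"
  shows "tensor_lift scaleV \<beta> (\<Delta> (a + b)) = tensor_lift scaleV \<beta> (\<Delta> a) + tensor_lift scaleV \<beta> (\<Delta> b)"
proof -
  obtain p q where pq: "\<Delta> a = tensor_class scale p" "\<Delta> b = tensor_class scale q"
    using comultiplication_classE[OF \<Delta>] by metis
  have "\<Delta> (a + b) = tensor_class scale (p + q)"
    using \<Delta> by (simp add: comultiplication_def pq tensor_add_class)
  then show ?thesis
    by (simp add: pq tensor_lift_class[OF V \<beta>] free_eval_add[OF V])
qed

lemma bilinear_map_add:
  assumes "bilinear_map scale scaleV \<beta>" "bilinear_map scale scaleV \<gamma>"
  shows "bilinear_map scale scaleV (\<lambda>x y. \<beta> x y + \<gamma> x y)"
proof -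
  have "vector_space_pair scale scaleV"
    using assms(1) unfolding bilinear_map_def Vector_Spaces.linear_def vector_space_pair_def by blast
  then interpret vector_space_pair scale scaleV .
  show ?thesis using assms by (auto simp: bilinear_map_def intro: linear_compose_add)
qed

text \<open>All three sums are evaluated on one representative of \<open>\<Delta> a\<close>. This
  yields additivity in the functional arguments, as \<open>tensor_lift_comult_add\<close> does in
  the element argument.\<close>

lemma tensor_lift_comult_add_map:
  assumes V: "vector_space scaleV" and \<beta>: "bilinear_map scale scaleV \<beta>"
    and \<gamma>: "bilinear_map scale scaleV \<gamma>" and \<Delta>: "comultiplication scale \<Delta>"
  shows "tensor_lift scaleV (\<lambda>x y. \<beta> x y + \<gamma> x y) (\<Delta> a)
    = tensor_lift scaleV \<beta> (\<Delta> a) + tensor_lift scaleV \<gamma> (\<Delta> a)"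
proof -
  interpret vector_space scaleV by fact
  obtain p where p: "\<Delta> a = tensor_class scale p"
    using comultiplication_classE[OF \<Delta>] .
  show ?thesis
    unfolding p tensor_lift_class[OF V \<beta>] tensor_lift_class[OF V \<gamma>]
      tensor_lift_class[OF V bilinear_map_add[OF \<beta> \<gamma>]]
    by (simp add: free_eval_def case_prod_beta scale_right_distrib sum.distrib)
qed


section \<open>The algebra structure of the double\<close>

locale drinfeld_double = finite_dimensional_algebra scale Basis mul
  for scale :: "'f::field \<Rightarrow> 'a::ab_group_add \<Rightarrow> 'a" and Basis :: "'a set" and mul +
  fixes \<Delta> :: "'a \<Rightarrow> ('a, 'f) free_pairs set"
  assumes comult: "comultiplication scale \<Delta>"
begin

abbreviation "D \<equiv> double scale"
abbreviation "sD \<equiv> double_scale scale"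
abbreviation dmul (infixl "\<star>" 70) where "dmul \<equiv> double_mul scale mul \<Delta>"

lemma linear_mul_right: "Vector_Spaces.linear scale scale (\<lambda>y. mul x y)"
  and linear_mul_left: "Vector_Spaces.linear scale scale (\<lambda>x. mul x y)"
  using bilinear_mul by (auto simp: bilinear_map_def)

lemmas mul_add_right = module_hom.add[OF Vector_Spaces.linear.axioms(3)[OF linear_mul_right]]
  and mul_add_left = module_hom.add[OF Vector_Spaces.linear.axioms(3)[OF linear_mul_left]]
  and mul_zero_left = module_hom.zero[OF Vector_Spaces.linear.axioms(3)[OF linear_mul_left]]

lemma vector_space_field: "vector_space ((*) :: 'f \<Rightarrow> _)"
  by unfold_locales (simp_all add: algebra_simps)

lemma dual_iff: "f \<in> dual_space scale \<longleftrightarrow>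
    (\<forall>x y. f (x + y) = f x + f y) \<and> (\<forall>c x. f (scale c x) = c * f x)"
  unfolding dual_space_def Vector_Spaces.linear_def module_hom_def module_hom_axioms_def
    module_iff_vector_space by (auto simp: vector_space_axioms vector_space_field)

lemma bilinear_mapI:
  assumes "vector_space scaleV"
    and "\<And>x y z. \<beta> (x + y) z = \<beta> x z + \<beta> y z" "\<And>x y z. \<beta> z (x + y) = \<beta> z x + \<beta> z y"
    and "\<And>c x y. \<beta> (scale c x) y = scaleV c (\<beta> x y)" "\<And>c x y. \<beta> x (scale c y) = scaleV c (\<beta> x y)"
  shows "bilinear_map scale scaleV \<beta>"
  using assms unfolding bilinear_map_def Vector_Spaces.linear_def module_hom_def
    module_hom_axioms_def module_iff_vector_space by (simp add: vector_space_axioms)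

section \<open>Additivity of the actions and products of the double\<close>

lemma bilinear_left:
  assumes "f \<in> dual_space scale"
  shows "bilinear_map scale scale (\<lambda>x y. scale (f y) x)"
  using assms by (intro bilinear_mapI) (auto simp: dual_iff algebra_simps vector_space_axioms)

lemma bilinear_right:
  assumes "f \<in> dual_space scale"
  shows "bilinear_map scale scale (\<lambda>x y. scale (f x) y)"
  using assms by (intro bilinear_mapI) (auto simp: dual_iff algebra_simps vector_space_axioms)

lemma bilinear_mult:
  assumes "f \<in> dual_space scale" "g \<in> dual_space scale"
  shows "bilinear_map scale (*) (\<lambda>x y. f x * g y)"
  using assms by (intro bilinear_mapI) (auto simp: dual_iff algebra_simps vector_space_field)

lemma dual_act_left_add_element:
  assumes "f \<in> dual_space scale"
  shows "dual_act_left scale \<Delta> f (a + b) = dual_act_left scale \<Delta> f a + dual_act_left scale \<Delta> f b"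
  using tensor_lift_comult_add[OF vector_space_axioms bilinear_left[OF assms] comult]
  by (simp add: dual_act_left_def)

lemma dual_act_left_add_functional:
  assumes "f \<in> dual_space scale" "g \<in> dual_space scale"
  shows "dual_act_left scale \<Delta> (f + g) a = dual_act_left scale \<Delta> f a + dual_act_left scale \<Delta> g a"
  using tensor_lift_comult_add_map[OF vector_space_axioms bilinear_left[OF assms(1)]
      bilinear_left[OF assms(2)] comult]
  by (simp add: dual_act_left_def scale_left_distrib)

lemma dual_act_right_add_element:
  assumes "f \<in> dual_space scale"
  shows "dual_act_right scale \<Delta> (a + b) f = dual_act_right scale \<Delta> a f + dual_act_right scale \<Delta> b f"
  using tensor_lift_comult_add[OF vector_space_axioms bilinear_right[OF assms] comult]
  by (simp add: dual_act_right_def)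

lemma dual_act_right_add_functional:
  assumes "f \<in> dual_space scale" "g \<in> dual_space scale"
  shows "dual_act_right scale \<Delta> a (f + g) = dual_act_right scale \<Delta> a f + dual_act_right scale \<Delta> a g"
  using tensor_lift_comult_add_map[OF vector_space_axioms bilinear_right[OF assms(1)]
      bilinear_right[OF assms(2)] comult]
  by (simp add: dual_act_right_def scale_left_distrib)

lemmas dual_act_add = dual_act_left_add_element dual_act_left_add_functional
  dual_act_right_add_element dual_act_right_add_functional

lemma dual_mul_add:
  assumes "f \<in> dual_space scale" "g \<in> dual_space scale" "h \<in> dual_space scale"
  shows "dual_mul \<Delta> (f + g) h = dual_mul \<Delta> f h + dual_mul \<Delta> g h"
    and "dual_mul \<Delta> h (f + g) = dual_mul \<Delta> h f + dual_mul \<Delta> h g"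
  using tensor_lift_comult_add_map[OF vector_space_field bilinear_mult[OF assms(1,3)]
      bilinear_mult[OF assms(2,3)] comult]
    tensor_lift_comult_add_map[OF vector_space_field bilinear_mult[OF assms(3,1)]
      bilinear_mult[OF assms(3,2)] comult]
  by (simp_all add: dual_mul_def fun_eq_iff algebra_simps)

lemma zero_dual: "0 \<in> dual_space scale" by (simp add: dual_iff)

lemma dual_act_zero: "dual_act_left scale \<Delta> 0 a = 0" "dual_act_right scale \<Delta> a 0 = 0"
  using dual_act_left_add_functional[OF zero_dual zero_dual, of a]
    dual_act_right_add_functional[OF zero_dual zero_dual, of a] by simp_all

lemma dual_mul_zero:
  assumes "f \<in> dual_space scale"
  shows "dual_mul \<Delta> 0 f = 0"
  using dual_mul_add(1)[OF zero_dual zero_dual assms] by simp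

lemma D_iff: "x \<in> D \<longleftrightarrow> snd x \<in> dual_space scale"
  by (cases x) (simp add: double_def)

text \<open>Membership in \<open>D\<close> makes the functional components linear, hence the
  integrands bilinear and the Sweedler sums independent of representatives.\<close>

lemma dmul_add:
  assumes "x \<in> D" "y \<in> D" "z \<in> D"
  shows "(x + y) \<star> z = x \<star> z + y \<star> z" and "z \<star> (x + y) = z \<star> x + z \<star> y"
proof -
  obtain a b c f g h where [simp]: "x = (a, f)" "y = (b, g)" "z = (c, h)"
    by (metis surj_pair)
  have d: "f \<in> dual_space scale" "g \<in> dual_space scale" "h \<in> dual_space scale"
    using assms by (simp_all add: D_iff)
  have dh: "h (u + v) = h u + h v" for u v using d by (simp add: dual_iff)
  have df: "f (u + v) = f u + f v" "g (u + v) = g u + g v" for u v using d by (simp_all add: dual_iff)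
  show "(x + y) \<star> z = x \<star> z + y \<star> z"
    by (simp add: double_mul_def dual_act_add dual_mul_add d mul_add_left
      alg_act_right_def alg_act_left_def fun_eq_iff dh df mul_add_right)
  show "z \<star> (x + y) = z \<star> x + z \<star> y"
    by (simp add: double_mul_def dual_act_add dual_mul_add d mul_add_right
      alg_act_right_def alg_act_left_def fun_eq_iff dh df mul_add_left)
qed

text \<open>Every Sweedler term contains a zero functional and drops out.\<close>

lemma dmul_embed: "(a, 0) \<star> (b, 0) = (mul a b, 0)"
  by (simp add: double_mul_def dual_act_zero dual_mul_zero zero_dual alg_act_right_def alg_act_left_def
    fun_eq_iff)

text \<open>The ambient space has arbitrary functions as second components; the ideals of the double
  are subspaces of it contained in \<open>D\<close>.\<close>

sublocale DV: vector_space sD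
  by unfold_locales (auto simp: double_scale_def fun_eq_iff algebra_simps)

lemma embed_in_D: "(a, 0) \<in> D"
  by (simp add: D_iff zero_dual)

section \<open>Functionals and their values on the basis\<close>

lemma dual_eqI:
  assumes "f \<in> dual_space scale" "g \<in> dual_space scale" "\<And>b. b \<in> Basis \<Longrightarrow> f b = g b"
  shows "f = g"
proof
  fix x
  interpret vector_space_pair scale "(*) :: 'f \<Rightarrow> _"
    using vector_space_axioms vector_space_field by (rule vector_space_pair.intro)
  show "f x = g x"
    using assms span_Basis by (intro linear_eq_on[of f g x Basis]) (auto simp: dual_space_def)
qed

text \<open>No dimension of the dual space is needed: its elements are the coefficient vectors of
  elements of \<open>A\<close> with respect to the basis.\<close>

lemma linear_inj_dual_surj:
  assumes add: "\<And>a b. \<psi> (a + b) = \<psi> a + \<psi> b" and scale: "\<And>c a x. \<psi> (scale c a) x = c * \<psi> a x"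
    and ran: "\<And>a. \<psi> a \<in> dual_space scale" and ker: "\<And>a. \<psi> a = 0 \<Longrightarrow> a = 0"
    and f: "f \<in> dual_space scale"
  obtains a where "\<psi> a = f"
proof -
  \<comment> \<open>\<open>T\<close> is \<open>\<psi>\<close> followed by sending a functional to
    the element whose coordinates are its basis values. As an endomorphism of \<open>A\<close>, it
    is surjective once it is injective.\<close>
  define T where "T a = (\<Sum>b\<in>Basis. scale (\<psi> a b) b)" for a
  have lin: "Vector_Spaces.linear scale scale T"
    by (unfold_locales)
      (simp_all add: T_def add scale scale_left_distrib sum.distrib scale_sum_right)
  interpret T: Vector_Spaces.linear scale scale T by (rule lin)
  have coeff: "g b = h b" if "(\<Sum>b\<in>Basis. scale (g b) b) = (\<Sum>b\<in>Basis. scale (h b) b)" "b \<in> Basis"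
    for g h b
  proof -
    have "(\<Sum>b\<in>Basis. scale (g b - h b) b) = 0"
      using that(1) by (simp add: scale_left_diff_distrib sum_subtractf)
    then show ?thesis
      using independentD[OF independent_Basis finite_Basis order_refl _ that(2), of "\<lambda>b. g b - h b"]
      by simp
  qed
  have "inj T"
    unfolding T.inj_iff_eq_0
  proof (intro allI impI)
    fix a assume "T a = 0"
    then have "\<psi> a = 0"
      by (intro dual_eqI ran zero_dual) (auto intro!: coeff simp: T_def)
    then show "a = 0" by (rule ker)
  qed
  then have "surj T" using lin by (rule linear_inj_imp_surj[rotated])
  then obtain a where a: "T a = (\<Sum>b\<in>Basis. scale (f b) b)" by (metis surjD)
  have "\<psi> a = f"
    by (intro dual_eqI ran f) (use a coeff in \<open>auto simp: T_def\<close>)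
  then show ?thesis by (rule that)
qed

section \<open>Ideals of the double and simplicity of \<open>A\<close>\<close>

lemma ideal_addD:
  assumes "two_sided_ideal sD (\<star>) D I" "x \<in> I" "y \<in> I"
  shows "x + y \<in> I" "x - y \<in> I"
  using assms DV.subspace_add DV.subspace_diff by (auto simp: two_sided_ideal_def)

lemma ideal_mult:
  assumes "two_sided_ideal sD (\<star>) D I" "x \<in> D" "y \<in> I"
  shows "x \<star> y \<in> I" "y \<star> x \<in> I"
  using assms by (auto simp: two_sided_ideal_def)

lemma ideal_subset:
  assumes "two_sided_ideal sD (\<star>) D I" "x \<in> I"
  shows "x \<in> D"
  using assms by (auto simp: two_sided_ideal_def)

text \<open>The span contains every product, so it is an ideal; it is nonzero because the product is
  not identically zero, and simplicity leaves only the whole algebra.\<close>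

lemma span_products:
  assumes "simple_algebra scale mul UNIV"
  shows "span {mul a b |a b. True} = UNIV"
proof -
  let ?P = "span {mul a b |a b. True}"
  have "mul a b \<in> ?P" for a b by (rule span_base) blast
  then have "two_sided_ideal scale mul UNIV ?P"
    by (simp add: two_sided_ideal_def)
  moreover obtain a b where "mul a b \<noteq> 0"
    using assms by (auto simp: simple_algebra_def)
  then have "?P \<noteq> {0}" using \<open>\<And>b a. mul a b \<in> ?P\<close> by (metis singletonD)
  ultimately show ?thesis using assms by (auto simp: simple_algebra_def)
qed

lemma dual_zero_of_products:
  assumes simple: "simple_algebra scale mul UNIV" and f: "f \<in> dual_space scale"
    and "\<And>a b. f (mul a b) = 0"
  shows "f = 0"
proof
  fix x
  interpret f: Vector_Spaces.linear scale "(*)" f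
    using f by (simp add: dual_space_def)
  have "x \<in> span {mul a b |a b. True}" using span_products[OF simple] by simp
  then have "f x = 0" by (rule f.eq_0_on_span[rotated]) (use assms(3) in blast)
  then show "f x = 0 x" by simp
qed

lemma simple_nonzero:
  assumes "simple_algebra sD (\<star>) S"
  shows "S \<noteq> {0}"
proof
  assume "S = {0}"
  moreover have "(0, 0) \<star> (0, 0) = (0, 0)" by (simp add: dmul_embed mul_zero_left)
  moreover have "\<exists>x\<in>S. \<exists>y\<in>S. x \<star> y \<noteq> 0" using assms unfolding simple_algebra_def by blast
  ultimately show False by (simp add: zero_prod_def)
qed

lemma ideal_not_contains_algebra:
  assumes simple: "simple_algebra scale mul UNIV"
    and I: "two_sided_ideal sD (\<star>) D I" and J: "two_sided_ideal sD (\<star>) D J"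
    and IJ: "I \<inter> J = {0}" and J_nonzero: "J \<noteq> {0}"
  shows "\<not> range (\<lambda>a. (a, 0)) \<subseteq> I"
proof
  assume A: "range (\<lambda>a. (a, 0)) \<subseteq> I"
  have "x = 0" if x: "x \<in> J" for x
  proof -
    obtain b f where bf: "x = (b, f)" by (cases x)
    have f: "f \<in> dual_space scale" using ideal_subset[OF J x] by (simp add: D_iff bf)
    have "f (mul c a) = 0" for a c
    proof -
      have "(a, 0) \<star> x \<in> I \<inter> J"
        using A ideal_mult(2)[OF I ideal_subset[OF J x], of "(a, 0)"]
          ideal_mult(1)[OF J embed_in_D x] by auto
      \<comment> \<open>In the functional component of \<open>(a, 0) \<star> (b, f)\<close> only the
        action of \<open>a\<close> on \<open>f\<close> survives; its value at \<open>c\<close> is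
        \<open>f (mul c a)\<close>.\<close>
      then have "snd ((a, 0) \<star> x) c = 0" using IJ by auto
      then show ?thesis
        by (simp add: double_mul_def bf dual_mul_zero f alg_act_left_def alg_act_right_def)
    qed
    then have "f = 0" by (rule dual_zero_of_products[OF simple f])
    \<comment> \<open>With \<open>f = 0\<close> the element \<open>x\<close> is in the image of
      \<open>A\<close>, hence in \<open>I\<close>.\<close>
    then have "x \<in> I \<inter> J" using A x by (auto simp: bf)
    then show ?thesis using IJ by auto
  qed
  moreover have "0 \<in> J" using J DV.subspace_0 by (auto simp: two_sided_ideal_def)
  ultimately show False using J_nonzero by auto
qed

text \<open>The preimage of \<open>I\<close> under the embedding of \<open>A\<close> is an ideal of
  \<open>A\<close>, hence zero or everything; the latter is excluded by assumption.\<close>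

lemma ideal_meets_algebra_trivially:
  assumes simple: "simple_algebra scale mul UNIV"
    and I: "two_sided_ideal sD (\<star>) D I" and "\<not> range (\<lambda>a. (a, 0)) \<subseteq> I"
    and "(a, 0) \<in> I"
  shows "a = 0"
proof -
  let ?K = "{a. (a, 0) \<in> I}"
  have sI: "DV.subspace I" using I by (simp add: two_sided_ideal_def)
  have "subspace ?K"
  proof (rule subspaceI)
    show "0 \<in> ?K" using DV.subspace_0[OF sI] by (simp add: zero_prod_def)
    show "x + y \<in> ?K" if "x \<in> ?K" "y \<in> ?K" for x y
      using DV.subspace_add[OF sI, of "(x, 0)" "(y, 0)"] that by simp
    show "scale c x \<in> ?K" if "x \<in> ?K" for c x
      using DV.subspace_scale[OF sI, of "(x, 0)" c] that
      by (simp add: double_scale_def zero_fun_def)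
  qed
  moreover have "mul x y \<in> ?K \<and> mul y x \<in> ?K" if "y \<in> ?K" for x y
    using ideal_mult[OF I embed_in_D, of "(y, 0)" x] that by (simp add: dmul_embed)
  ultimately have "two_sided_ideal scale mul UNIV ?K"
    by (simp add: two_sided_ideal_def)
  then have "?K = {0} \<or> ?K = UNIV" using simple by (simp add: simple_algebra_def)
  then show ?thesis using assms(3,4) by blast
qed

end


section \<open>Splitting doubles\<close>

text \<open>\<open>I\<close> and \<open>J\<close> stand for the two summands. Simplicity enters
  through the last two assumptions: neither summand meets \<open>A\<close>.\<close>

locale split_drinfeld_double = drinfeld_double +
  fixes I J
  assumes ideal_I: "two_sided_ideal sD (\<star>) D I" and ideal_J: "two_sided_ideal sD (\<star>) D J"
    and direct: "direct_sum D I J"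
    and I_trivial: "(a, 0) \<in> I \<Longrightarrow> a = 0" and J_trivial: "(a, 0) \<in> J \<Longrightarrow> a = 0"
begin

section \<open>The projection of \<open>D\<close> onto \<open>J\<close> along
  \<open>I\<close>\<close>

definition proj where "proj x = (THE v. v \<in> J \<and> x - v \<in> I)"

text \<open>Two candidates for the value differ by an element of \<open>I \<inter> J\<close>. The
  later computations of projections go through this criterion.\<close>

lemma proj_eq:
  assumes "v \<in> J" "x - v \<in> I"
  shows "proj x = v"
  unfolding proj_def
proof (rule the_equality)
  fix w assume w: "w \<in> J \<and> x - w \<in> I"
  have "w - v \<in> J" using w assms ideal_addD(2)[OF ideal_J] by blast
  moreover have "w - v = (x - v) - (x - w)" by simp
  then have "w - v \<in> I" using w assms ideal_addD(2)[OF ideal_I] by metis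
  ultimately have "w - v = 0" using direct unfolding direct_sum_def by blast
  then show "w = v" by simp
qed (use assms in blast)

lemma proj_mem:
  assumes "x \<in> D"
  shows "proj x \<in> J" "x - proj x \<in> I"
proof -
  obtain u v where "u \<in> I" "v \<in> J" "x = u + v"
    using assms direct by (auto simp: direct_sum_def)
  moreover from this have "proj x = v" by (intro proj_eq) auto
  ultimately show "proj x \<in> J" "x - proj x \<in> I" by auto
qed

lemma proj_in_D: "x \<in> D \<Longrightarrow> proj x \<in> D"
  by (rule ideal_subset[OF ideal_J proj_mem(1)])

lemma diff_proj_in_D: "x \<in> D \<Longrightarrow> x - proj x \<in> D"
  by (rule ideal_subset[OF ideal_I proj_mem(2)])

lemma proj_add:
  assumes "x \<in> D" "y \<in> D"
  shows "proj (x + y) = proj x + proj y"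
proof (rule proj_eq)
  have "(x - proj x) + (y - proj y) \<in> I" by (intro ideal_addD[OF ideal_I] proj_mem assms)
  then show "x + y - (proj x + proj y) \<in> I" by (simp add: algebra_simps)
qed (intro ideal_addD[OF ideal_J] proj_mem assms)

lemma proj_scale:
  assumes "x \<in> D"
  shows "proj (sD c x) = sD c (proj x)"
proof (rule proj_eq)
  have "sD c (x - proj x) \<in> I"
    using ideal_I proj_mem[OF assms] DV.subspace_scale by (auto simp: two_sided_ideal_def)
  then show "sD c x - sD c (proj x) \<in> I" by (simp add: DV.scale_right_diff_distrib)
  show "sD c (proj x) \<in> J"
    using ideal_J proj_mem[OF assms] DV.subspace_scale by (auto simp: two_sided_ideal_def)
qed

text \<open>Split one factor into its parts in \<open>I\<close> and \<open>J\<close>; both ideals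
  absorb the other factor, so the two products are the parts of \<open>x \<star> y\<close>.\<close>

lemma proj_mult:
  assumes x: "x \<in> D" and y: "y \<in> D"
  shows "proj (x \<star> y) = x \<star> proj y" "proj (x \<star> y) = proj x \<star> y"
proof -
  have "x \<star> y = x \<star> (y - proj y) + x \<star> proj y"
    using dmul_add(2)[OF diff_proj_in_D[OF y] proj_in_D[OF y] x] by simp
  then have "x \<star> y - x \<star> proj y \<in> I"
    using ideal_mult(1)[OF ideal_I x proj_mem(2)[OF y]] by simp
  then show "proj (x \<star> y) = x \<star> proj y"
    by (intro proj_eq ideal_mult(1)[OF ideal_J x proj_mem(1)[OF y]])
  have "x \<star> y = (x - proj x) \<star> y + proj x \<star> y"
    using dmul_add(1)[OF diff_proj_in_D[OF x] proj_in_D[OF x] y] by simp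
  then have "x \<star> y - proj x \<star> y \<in> I"
    using ideal_mult(2)[OF ideal_I y proj_mem(2)[OF x]] by simp
  then show "proj (x \<star> y) = proj x \<star> y"
    by (intro proj_eq ideal_mult(2)[OF ideal_J y proj_mem(1)[OF x]])
qed

lemma proj_proj:
  assumes "x \<in> D"
  shows "proj (proj x) = proj x"
proof (rule proj_eq)
  show "proj x - proj x \<in> I"
    using ideal_I DV.subspace_0 by (simp add: two_sided_ideal_def)
qed (rule proj_mem(1)[OF assms])

section \<open>The components of the projection on \<open>A\<close>\<close>

definition Q where "Q a = fst (proj (a, 0))"

text \<open>The sign makes \<open>(0, \<psi> a) - (Q a, 0)\<close> equal to
  \<open>- proj (a, 0)\<close>, an element of \<open>J\<close>, as the defining condition of
  \<open>double_phi J\<close> requires.\<close>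

definition \<psi> where "\<psi> a = - snd (proj (a, 0))"

lemma proj_embed: "proj (a, 0) = (Q a, - \<psi> a)"
  by (simp add: Q_def \<psi>_def)

lemma proj_embed_add: "proj (a + b, 0) = proj (a, 0) + proj (b, 0)"
  using proj_add[OF embed_in_D embed_in_D, of a b] by simp

lemma proj_embed_scale: "proj (scale c a, 0) = sD c (proj (a, 0))"
  using proj_scale[OF embed_in_D, of c a] by (simp add: double_scale_def zero_fun_def)

lemma linear_Q: "Vector_Spaces.linear scale scale Q"
  by unfold_locales
    (simp_all add: Q_def proj_embed_add proj_embed_scale double_scale_def case_prod_beta)

lemma \<psi>_dual: "\<psi> a \<in> dual_space scale"
  using proj_in_D[OF embed_in_D[of a]] by (simp add: \<psi>_def D_iff dual_iff)

lemma \<psi>_add: "\<psi> (a + b) = \<psi> a + \<psi> b"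
  by (simp add: \<psi>_def proj_embed_add)

lemma \<psi>_scale: "\<psi> (scale c a) x = c * \<psi> a x"
  by (simp add: \<psi>_def proj_embed_scale double_scale_def case_prod_beta)

text \<open>If the functional component vanishes, both parts of \<open>(a, 0)\<close> lie in
  \<open>A\<close>; each is then zero, and so is their sum.\<close>

lemma \<psi>_eq_zero:
  assumes "\<psi> a = 0"
  shows "a = 0"
proof -
  have "(Q a, 0) \<in> J" using proj_mem(1)[OF embed_in_D, of a] by (simp add: proj_embed assms)
  then have "Q a = 0" by (rule J_trivial)
  moreover have "(a - Q a, 0) \<in> I"
    using proj_mem(2)[OF embed_in_D, of a] by (simp add: proj_embed assms)
  then have "a - Q a = 0" by (rule I_trivial)
  ultimately show ?thesis by simp
qed

section \<open>Identification with \<open>double_phi\<close> and \<open>double_psi\<close>\<close>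

lemma phi_eqI:
  assumes "two_sided_ideal sD (\<star>) D K" "\<And>a. (a, 0) \<in> K \<Longrightarrow> a = 0" "(0, f) - (a, 0) \<in> K"
  shows "double_phi K f = a"
  unfolding double_phi_def
proof (rule the_equality)
  fix b assume "(0, f) - (b, 0) \<in> K"
  \<comment> \<open>The functional cancels between two candidates, leaving an element of
    \<open>A\<close> inside \<open>K\<close>.\<close>
  then have "((0, f) - (a, 0)) - ((0, f) - (b, 0)) \<in> K"
    by (rule ideal_addD(2)[OF assms(1,3)])
  then have "(b - a, 0) \<in> K" by simp
  then have "b - a = 0" by (rule assms(2))
  then show "b = a" by simp
qed (rule assms(3))

lemma phi_\<psi>: "double_phi I (\<psi> a) = Q a - a" "double_phi J (\<psi> a) = Q a"
proof -
  \<comment> \<open>The \<open>I\<close>-part of \<open>(a, 0)\<close> has functional component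
    \<open>\<psi> a\<close>, so it already has the form that defines
    \<open>double_phi I\<close>.\<close>
  have "(0, \<psi> a) - (Q a - a, 0) = (a, 0) - proj (a, 0)" by (simp add: proj_embed)
  then show "double_phi I (\<psi> a) = Q a - a"
    using proj_mem(2)[OF embed_in_D, of a] by (intro phi_eqI ideal_I I_trivial) auto
  have "(0, \<psi> a) - (Q a, 0) = - proj (a, 0)" by (simp add: proj_embed)
  moreover have "- proj (a, 0) \<in> J"
    using ideal_J proj_mem(1)[OF embed_in_D] DV.subspace_neg by (auto simp: two_sided_ideal_def)
  ultimately show "double_phi J (\<psi> a) = Q a"
    by (intro phi_eqI ideal_J J_trivial) auto
qed

lemma psi_eq: "double_psi scale I J a = \<psi> a"
  unfolding double_psi_def
proof (rule the_equality)
  fix f assume f: "f \<in> dual_space scale \<and> a = - double_phi I f + double_phi J f"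
  \<comment> \<open>Surjectivity of \<open>\<psi>\<close> brings any competitor into a form where
    \<open>phi_\<psi>\<close> applies; the condition on \<open>f\<close> then reads
    \<open>a = - (Q b - b) + Q b\<close>, that is, \<open>a = b\<close>.\<close>
  then obtain b where "f = \<psi> b"
    using linear_inj_dual_surj[of \<psi> f] \<psi>_add \<psi>_scale \<psi>_dual \<psi>_eq_zero by metis
  then show "f = \<psi> a" using f by (simp add: phi_\<psi>)
qed (simp add: \<psi>_dual phi_\<psi>)

section \<open>The Rota-Baxter identity\<close>

lemma Q_identity: "mul (Q a) (Q b) = Q (mul (Q a) b + mul a (Q b) + scale (- 1) (mul a b))"
proof -
  interpret Q: Vector_Spaces.linear scale scale Q by (rule linear_Q)
  \<comment> \<open>The factor \<open>(Q a, 0)\<close> stays fixed while the projection passes to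
    the other factor.\<close>
  have 1: "Q (mul (Q a) b) = fst ((Q a, 0) \<star> proj (b, 0))"
    by (simp add: Q_def flip: dmul_embed proj_mult(1)[OF embed_in_D embed_in_D])
  have 2: "Q (mul a (Q b)) = fst (proj (a, 0) \<star> (Q b, 0))"
    by (simp add: Q_def flip: dmul_embed proj_mult(2)[OF embed_in_D embed_in_D])
  \<comment> \<open>Idempotence supplies a second projection, so that one can be moved to each
    factor.\<close>
  have "proj ((a, 0) \<star> (b, 0)) = proj (proj ((a, 0) \<star> (b, 0)))"
    unfolding dmul_embed by (rule proj_proj[OF embed_in_D, symmetric])
  also have "\<dots> = proj (a, 0) \<star> proj (b, 0)"
    by (simp only: proj_mult(2)[OF embed_in_D embed_in_D]
        proj_mult(1)[OF proj_in_D[OF embed_in_D] embed_in_D])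
  finally have 3: "Q (mul a b) = fst (proj (a, 0) \<star> proj (b, 0))"
    by (simp add: Q_def dmul_embed)
  \<comment> \<open>In first components, each of the three products contributes
    \<open>mul (Q a) (Q b)\<close>. The action of \<open>- \<psi> b\<close> on \<open>Q a\<close>
    occurs in 1 and 3, that of \<open>- \<psi> a\<close> on \<open>Q b\<close> in 2 and 3, so 1 + 2
    - 3 leaves a single \<open>mul (Q a) (Q b)\<close>.\<close>
  show ?thesis
    by (simp add: Q.add Q.diff 1 2 3) (simp add: proj_embed double_mul_def dual_act_zero)
qed

lemma rota_baxter_Q: "rota_baxter scale mul (- 1) (\<lambda>a. double_phi J (double_psi scale I J a))"
  unfolding psi_eq phi_\<psi> rota_baxter_def by (intro conjI allI linear_Q Q_identity)

end

theorem theorem2: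
  fixes scale :: "'f::field_char_0 \<Rightarrow> 'a::ab_group_add \<Rightarrow> 'a"
    and Basis :: "'a set"
    and mul :: "'a \<Rightarrow> 'a \<Rightarrow> 'a"
    and \<Delta> :: "'a \<Rightarrow> ('a, 'f) free_pairs set"
    and A1 A2 :: "('a \<times> ('a \<Rightarrow> 'f)) set"
  assumes "finite_dimensional_algebra scale Basis mul"
    and "simple_algebra scale mul UNIV"
    and "comultiplication scale \<Delta>"
    and "two_sided_ideal (double_scale scale) (double_mul scale mul \<Delta>) (double scale) A1"
    and "two_sided_ideal (double_scale scale) (double_mul scale mul \<Delta>) (double scale) A2"
    and "simple_algebra (double_scale scale) (double_mul scale mul \<Delta>) A1"
    and "simple_algebra (double_scale scale) (double_mul scale mul \<Delta>) A2"
    and "direct_sum (double scale) A1 A2"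
  shows "rota_baxter scale mul (- 1) (\<lambda>a. double_phi A2 (double_psi scale A1 A2 a))"
proof -
  interpret drinfeld_double scale Basis mul \<Delta>
    using assms(1,3) by (rule drinfeld_double.intro[OF _ drinfeld_double_axioms.intro])
  note nonzero = simple_nonzero[OF assms(6)] simple_nonzero[OF assms(7)]
  have int: "A1 \<inter> A2 = {0}" "A2 \<inter> A1 = {0}" using assms(8) unfolding direct_sum_def by blast+
  \<comment> \<open>\<open>A1\<close> cannot contain \<open>A\<close> because the other summand is
    nonzero; the same argument with the roles exchanged handles \<open>A2\<close>.\<close>
  have A1: "a = 0" if "(a, 0) \<in> A1" for a
    using that by (rule ideal_meets_algebra_trivially[OF assms(2,4)
        ideal_not_contains_algebra[OF assms(2,4,5) int(1) nonzero(2)]])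
  have A2: "a = 0" if "(a, 0) \<in> A2" for a
    using that by (rule ideal_meets_algebra_trivially[OF assms(2,5)
        ideal_not_contains_algebra[OF assms(2,5,4) int(2) nonzero(1)]])
  interpret split_drinfeld_double scale Basis mul \<Delta> A1 A2
    by (intro split_drinfeld_double.intro split_drinfeld_double_axioms.intro
        drinfeld_double_axioms assms(4,5,8) A1 A2)
  show ?thesis by (rule rota_baxter_Q)
qed

end
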